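(* Let $q$ be a prime power, $n\ge1$, and let $k$ be an odd integer with $1\le k\le n$. Let $U\subseteq H_n(\mathbb{F}_{q^2})$ be any constant rank-distance $k$ set. Then $|U|\le q^k$.
   Context: $H_n(\mathbb{F}_{q^2})$ is the set of $n\times n$ hermitian matrices over $\mathbb{F}_{q^2}$ (matrices $A$ with $\overline{A}^T=A$, $\overline{\cdot}$ being $x\mapsto x^q$ entrywise). A constant rank-distance $k$ set is a set $U$ of $n\times n$ matrices with $\mathrm{rank}(A-B)=k$ for all distinct $A,B\in U$ and $\mathrm{rank}(A)=k$ for all nonzero $A\in U$. *)

theory Defs
  imports "HOL-Library.Cardinality" "HOL-Number_Theory.Number_Theory" "Jordan_Normal_Form.DL_Rank"
begin

text \<open>
  The field with \<open>q\<^sup>2\<close> elements is an arbitrary finite field type \<^typ>\<open>'a::{field,finite}\<close> with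
  \<open>CARD('a) = q\<^sup>2\<close>; that cardinality is assumed in the theorem, not in the definitions.
\<close>

definition conj_mat :: "nat \<Rightarrow> 'a::field mat \<Rightarrow> 'a mat" where
  "conj_mat q A = map_mat (\<lambda>x. x ^ q) A"

definition hermitian_mats :: "nat \<Rightarrow> nat \<Rightarrow> 'a::field mat set" where
  "hermitian_mats q n = {A \<in> carrier_mat n n. transpose_mat (conj_mat q A) = A}"

definition constant_rank_distance_set :: "nat \<Rightarrow> nat \<Rightarrow> 'a::field mat set \<Rightarrow> bool" where
  "constant_rank_distance_set n k U \<longleftrightarrow>
     U \<subseteq> carrier_mat n n \<and>
     (\<forall>A\<in>U. \<forall>B\<in>U. A \<noteq> B \<longrightarrow> vec_space.rank n (A - B) = k) \<and>
     (\<forall>A\<in>U. A \<noteq> 0\<^sub>m n n \<longrightarrow> vec_space.rank n A = k)"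

text \<open>
  Over a finite field every set of \<open>n \<times> n\<close> matrices is finite, so \<^const>\<open>card\<close> measures its size.
\<close>

lemma finite_carrier_mat: "finite (carrier_mat n m :: 'a::finite mat set)"
proof -
  have "(carrier_mat n m :: 'a mat set) \<subseteq>
      (\<lambda>f. mat n m f) ` (PiE ({..<n} \<times> {..<m}) (\<lambda>_. UNIV))"
  proof
    fix A :: "'a mat"
    assume A: "A \<in> carrier_mat n m"
    have "A = mat n m (restrict (\<lambda>ij. A $$ ij) ({..<n} \<times> {..<m}))"
      using A by (intro eq_matI) auto
    then show "A \<in> (\<lambda>f. mat n m f) ` (PiE ({..<n} \<times> {..<m}) (\<lambda>_. UNIV))"
      by (rule image_eqI[where x = "restrict (\<lambda>ij. A $$ ij) ({..<n} \<times> {..<m})"]) simp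
  qed
  then show ?thesis
    by (rule finite_subset) (auto intro!: finite_imageI finite_PiE)
qed

lemma finite_hermitian_mats: "finite (hermitian_mats q n :: 'a::{field,finite} mat set)"
  unfolding hermitian_mats_def by (rule finite_subset[OF _ finite_carrier_mat]) auto

end

theory Submission
  imports Defs "HOL-Analysis.Convex"
begin

text \<open>
  For each vector \<open>x\<close> the values \<open>x\<^sup>* A x\<close> of the members \<open>A\<close> of \<open>U\<close> lie in the subfield with
  \<open>q\<close> elements, so by Cauchy--Schwarz at least \<open>|U|\<^sup>2 / q\<close> pairs in \<open>U\<close> agree at \<open>x\<close>. On the
  other hand, \<open>A \<noteq> B\<close> agree exactly at the isotropic vectors of \<open>A - B\<close>. A hermitian form of
  rank \<open>k\<close> in \<open>n\<close> variables has \<open>(q\<^sup>2\<^sup>n + (-1)\<^sup>k (q - 1) q\<^sup>2\<^sup>n\<^sup>-\<^sup>k) / q\<close> isotropic vectors, which is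
  proved by splitting off one nonisotropic vector at a time; for odd \<open>k\<close> this is below the
  average \<open>q\<^sup>2\<^sup>n / q\<close>. Comparing the two counts over all \<open>x\<close> bounds \<open>|U|\<close> by \<open>q\<^sup>k + 1\<close>, and since
  all pairs agree at \<open>x = 0\<close>, the bound improves to \<open>q\<^sup>k\<close>.
\<close>

section \<open>Conjugation and norm on a field with \<open>q\<^sup>2\<close> elements\<close>

text \<open>Multiplication by a nonzero \<open>x\<close> permutes the units, so comparing the
  product of all units before and after gives \<open>x ^ (CARD('a) - 1) = 1\<close>.\<close>

lemma power_card_field_eq_self:
  fixes x :: "'a::{field,finite}"
  shows "x ^ CARD('a) = x"
proof (cases "x = 0")
  case False
  have "bij_betw ((*) x) (UNIV - {0}) (UNIV - {0})"
    by (rule bij_betw_byWitness[where f' = "\<lambda>y. y / x"]) (use False in auto)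
  then have "(\<Prod>y\<in>UNIV - {0}. x * y) = \<Prod>(UNIV - {0})"
    using prod.reindex_bij_betw[of "(*) x" "UNIV - {0}" "UNIV - {0}" "\<lambda>y. y"] by simp
  then have "x ^ (CARD('a) - 1) * \<Prod>(UNIV - {0 :: 'a}) = \<Prod>(UNIV - {0 :: 'a})"
    by (simp add: prod.distrib)
  then have "x ^ (CARD('a) - 1) = 1"
    by simp
  moreover have "CARD('a) = Suc (CARD('a) - 1)"
    by (simp add: finite_UNIV_card_ge_0)
  ultimately show ?thesis
    by (metis mult.right_neutral power_Suc)
qed (simp add: finite_UNIV_card_ge_0)

locale quadratic_extension =
  fixes q :: nat and ty :: "'a::{field,finite} itself"
  assumes primepow_q: "primepow q"
    and card_field: "CARD('a) = q ^ 2"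
begin

lemma q_gt_1: "q > 1"
  using primepow_q primepow_gt_Suc_0 by auto

lemma prime_CHAR: "prime CHAR('a)"
  using prime_CHAR_semidom[where ?'a = 'a] finite_imp_CHAR_pos[where ?'a = 'a] by simp

text \<open>This makes \<open>x ^ q\<close> an iterated Frobenius map, hence additive. The
  characteristic divides the field size, which is a power of the prime below
  \<open>q\<close>.\<close>

lemma q_power_CHAR: "\<exists>e. q = CHAR('a) ^ e"
proof -
  obtain p e where p: "prime p" "q = p ^ e"
    using primepow_q unfolding primepow_def by auto
  have "CHAR('a) dvd p ^ (e * 2)"
    using CHAR_dvd_CARD[where ?'a = 'a] card_field p(2) by (simp add: power_mult)
  then have "CHAR('a) dvd p"
    using prime_CHAR prime_dvd_power by blast
  then have "CHAR('a) = p"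
    using p(1) prime_CHAR primes_dvd_imp_eq by blast
  then show ?thesis
    using p by auto
qed

lemma conj_add: "(x + y :: 'a) ^ q = x ^ q + y ^ q"
  using q_power_CHAR freshmans_dream'[OF prime_CHAR] by blast

lemma conj_sum: "(\<Sum>i\<in>I. f i :: 'a) ^ q = (\<Sum>i\<in>I. f i ^ q)"
  using q_power_CHAR freshmans_dream_sum'[OF prime_CHAR] by blast

lemma conj_diff: "(x - y :: 'a) ^ q = x ^ q - y ^ q"
  using conj_add[of "x - y" y] by simp

lemma conj_minus: "(- x :: 'a) ^ q = - (x ^ q)"
  using conj_diff[of 0 x] q_gt_1 by simp

lemma conj_conj: "((x :: 'a) ^ q) ^ q = x"
  using power_card_field_eq_self[of x] by (simp add: card_field power_mult power2_eq_square)

text \<open>Fixed points of conjugation are roots of the nonzero polynomial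
  \<open>X^q - X\<close>.\<close>

lemma card_conj_fixed_le: "card {t :: 'a. t ^ q = t} \<le> q"
proof -
  let ?p = "monom 1 q - monom 1 1 :: 'a poly"
  have "coeff ?p q = 1"
    using q_gt_1 by simp
  then have "?p \<noteq> 0"
    by (metis coeff_0 zero_neq_one)
  then have "card {t. poly ?p t = 0} \<le> degree ?p"
    by (rule card_poly_roots_bound)
  also have "\<dots> \<le> q"
    using q_gt_1 by (intro degree_diff_le) (auto simp: degree_monom_eq)
  finally show ?thesis
    by (simp add: poly_monom)
qed

text \<open>If the trace vanished, \<open>c = 1\<close> would give \<open>1 = -1\<close>, so
  conjugation would be the identity and fix \<open>q ^ 2 > q\<close> elements. The argument is
  uniform in the characteristic.\<close>

lemma trace_nontrivial: "\<exists>c :: 'a. c ^ q + c \<noteq> 0"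
proof (rule ccontr)
  assume "\<not> ?thesis"
  then have all: "\<And>c :: 'a. c ^ q + c = 0"
    by blast
  from all[of 1] have "(1 :: 'a) = - 1"
    by (simp add: eq_neg_iff_add_eq_0)
  then have "\<And>c :: 'a. c ^ q = c"
    using all by (metis add_eq_0_iff mult_minus1 mult_1)
  then have "card {t :: 'a. t ^ q = t} = q ^ 2"
    using card_field by simp
  then show False
    using card_conj_fixed_le q_gt_1 by (simp add: power2_eq_square)
qed

lemma card_norm_fibre_le: "card {c :: 'a. c ^ (q + 1) = t} \<le> q + 1"
proof -
  let ?p = "monom 1 (q + 1) - [:t:] :: 'a poly"
  have "coeff ?p (q + 1) = 1"
    by simp
  then have "?p \<noteq> 0"
    by (metis coeff_0 zero_neq_one)
  then have "card {c. poly ?p c = 0} \<le> degree ?p"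
    by (rule card_poly_roots_bound)
  also have "\<dots> \<le> q + 1"
    by (intro degree_diff_le) (auto simp: degree_monom_eq)
  finally show ?thesis
    by (simp add: poly_monom)
qed

text \<open>The \<open>q\<^sup>2 - 1\<close> units are distributed over at most \<open>q - 1\<close> fibres of size at most
  \<open>q + 1\<close>, so all of these bounds are attained.\<close>
lemma card_norm_fibre:
  fixes t :: 'a
  assumes fixed: "t ^ q = t" and "t \<noteq> 0"
  shows "card {c :: 'a. c ^ (q + 1) = t} = q + 1"
proof (rule ccontr)
  assume neq: "\<not> ?thesis"
  define F where "F = {t :: 'a. t ^ q = t} - {0}"
  have t: "t \<in> F"
    using assms by (simp add: F_def)
  have "card F = card {t :: 'a. t ^ q = t} - 1"
    using q_gt_1 by (simp add: F_def)
  then have cF: "card F \<le> q - 1"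
    using card_conj_fixed_le by simp
  have maps: "c ^ (q + 1) \<in> F" if "c \<noteq> 0" for c :: 'a
    using that by (auto simp: F_def power_mult_distrib conj_conj)
  have "card (UNIV - {0 :: 'a}) = (\<Sum>t\<in>F. card {c \<in> UNIV - {0}. c ^ (q + 1) = t})"
    using sum_fun_comp[of "UNIV - {0 :: 'a}" F "\<lambda>c. c ^ (q + 1)" "\<lambda>_. 1 :: nat"] maps
    by (auto simp: image_subset_iff)
  also have "\<dots> < (\<Sum>t\<in>F. q + 1)"
  proof (rule sum_strict_mono_ex1)
    have le: "card {c \<in> UNIV - {0}. c ^ (q + 1) = t} \<le> card {c :: 'a. c ^ (q + 1) = t}" for t
      by (rule card_mono) auto
    then show "\<forall>t\<in>F. card {c \<in> UNIV - {0}. c ^ (q + 1) = t} \<le> q + 1"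
      using card_norm_fibre_le le_trans by blast
    have "card {c :: 'a. c ^ (q + 1) = t} < q + 1"
      using card_norm_fibre_le[of t] neq by simp
    then show "\<exists>t\<in>F. card {c \<in> UNIV - {0}. c ^ (q + 1) = t} < q + 1"
      using le t le_less_trans by blast
  qed (simp add: F_def)
  also have "\<dots> \<le> (q - 1) * (q + 1)"
    using mult_le_mono1[OF cF, of "q + 1"] by simp
  also have "\<dots> = q ^ 2 - 1"
    by (simp add: algebra_simps power2_eq_square diff_mult_distrib)
  finally show False
    using card_field by simp
qed

end

section \<open>Rank and kernel over a finite field\<close>

text \<open>Coordinates: each vector has exactly one extensional coefficient function on a basis, so
  it suffices to count these functions.\<close>

lemma (in vectorspace) card_carrier:
  assumes "fin_dim"
  shows "card (carrier V) = card (carrier K) ^ dim"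
proof -
  obtain B where B: "finite B" "basis B"
    using finite_basis_exists[OF assms] by blast
  then have "B \<subseteq> carrier V"
    by (simp add: basis_def)
  then have ex1: "\<forall>v. v \<in> carrier V \<longrightarrow> (\<exists>!a. a \<in> B \<rightarrow>\<^sub>E carrier K \<and> lincomb a B = v)"
    using iffD1[OF basis_criterion[OF B(1)] B(2)] by simp
  have "bij_betw (\<lambda>a. lincomb a B) (B \<rightarrow>\<^sub>E carrier K) (carrier V)"
    unfolding bij_betw_def
  proof
    have closed: "lincomb a B \<in> carrier V" if "a \<in> B \<rightarrow>\<^sub>E carrier K" for a
      using that \<open>B \<subseteq> carrier V\<close> by (intro lincomb_closed) auto
    show "inj_on (\<lambda>a. lincomb a B) (B \<rightarrow>\<^sub>E carrier K)"
    proof (rule inj_onI)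
      fix a b
      assume ab: "a \<in> B \<rightarrow>\<^sub>E carrier K" "b \<in> B \<rightarrow>\<^sub>E carrier K" "lincomb a B = lincomb b B"
      have "\<exists>!a'. a' \<in> B \<rightarrow>\<^sub>E carrier K \<and> lincomb a' B = lincomb a B"
        using ex1 closed[OF ab(1)] by blast
      then show "a = b"
        using ab by (elim ex1E) metis
    qed
    show "(\<lambda>a. lincomb a B) ` (B \<rightarrow>\<^sub>E carrier K) = carrier V"
    proof
      show "(\<lambda>a. lincomb a B) ` (B \<rightarrow>\<^sub>E carrier K) \<subseteq> carrier V"
        using closed by (rule image_subsetI)
      show "carrier V \<subseteq> (\<lambda>a. lincomb a B) ` (B \<rightarrow>\<^sub>E carrier K)"
        using ex1 by (auto simp: image_iff)
    qed
  qed
  then have "card (carrier V) = card (B \<rightarrow>\<^sub>E carrier K)"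
    by (simp add: bij_betw_same_card)
  then show ?thesis
    using B by (simp add: card_PiE dim_basis)
qed

lemma card_carrier_vec: "card (carrier_vec n :: 'a::{field,finite} vec set) = CARD('a) ^ n"
proof -
  interpret vec_space "TYPE('a)" n .
  show ?thesis
    using card_carrier[OF fin_dim] by (simp add: dim_is_n class_ring_simps)
qed

lemma finite_carrier_vec: "finite (carrier_vec n :: 'a::{field,finite} vec set)"
  by (rule card_ge_0_finite) (simp add: card_carrier_vec finite_UNIV_card_ge_0)

lemma card_col_space:
  fixes A :: "'a::{field,finite} mat"
  assumes A: "A \<in> carrier_mat n m"
  shows "card ((\<lambda>x. A *\<^sub>v x) ` carrier_vec m) = CARD('a) ^ vec_space.rank n A"
proof -
  interpret vec_space "TYPE('a)" n .
  have cols: "set (cols A) \<subseteq> carrier_vec n"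
    using A cols_dim by blast
  have vs: "vectorspace class_ring (span_vs (set (cols A)))"
    using cols span_is_subspace subspace_is_vs by simp
  have fd: "vectorspace.fin_dim class_ring (span_vs (set (cols A)))"
    using A by (rule fin_dim_span_cols)
  have "span (set (cols A)) = (\<lambda>x. A *\<^sub>v x) ` carrier_vec m"
    using col_space_eq[OF A] A unfolding col_space_def by auto
  then show ?thesis
    using vectorspace.card_carrier[OF vs fd] by (simp add: rank_def class_ring_simps)
qed

text \<open>Rank-nullity in multiplicative form: every fibre of \<open>A\<close> over its column
  space is a translate of the kernel.\<close>

lemma card_mat_kernel_times_rank:
  fixes A :: "'a::{field,finite} mat"
  assumes A: "A \<in> carrier_mat n m"
  shows "card {x \<in> carrier_vec m. A *\<^sub>v x = 0\<^sub>v n} * CARD('a) ^ vec_space.rank n A = CARD('a) ^ m"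
proof -
  let ?V = "carrier_vec m :: 'a vec set"
  let ?K = "{x \<in> ?V. A *\<^sub>v x = 0\<^sub>v n}"
  have fibre: "card {x \<in> ?V. A *\<^sub>v x = y} = card ?K" if "y \<in> (\<lambda>x. A *\<^sub>v x) ` ?V" for y
  proof -
    obtain u where u: "u \<in> ?V" "y = A *\<^sub>v u"
      using \<open>y \<in> _\<close> by blast
    have "bij_betw (\<lambda>x. x + u) ?K {x \<in> ?V. A *\<^sub>v x = y}"
      by (rule bij_betw_byWitness[where f' = "\<lambda>x. x - u"])
        (use A u in \<open>auto simp: mult_add_distrib_mat_vec mult_minus_distrib_mat_vec\<close>)
    then show ?thesis
      by (simp add: bij_betw_same_card)
  qed
  have "card ?V = (\<Sum>y\<in>(\<lambda>x. A *\<^sub>v x) ` ?V. card {x \<in> ?V. A *\<^sub>v x = y})"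
    using sum_fun_comp[of ?V "(\<lambda>x. A *\<^sub>v x) ` ?V" "\<lambda>x. A *\<^sub>v x" "\<lambda>_. 1 :: nat"]
    by (simp add: finite_carrier_vec)
  also have "\<dots> = CARD('a) ^ vec_space.rank n A * card ?K"
    using fibre by (simp add: card_col_space[OF A])
  finally show ?thesis
    by (simp add: card_carrier_vec mult.commute)
qed

section \<open>Hermitian forms\<close>

definition hermitian_form :: "nat \<Rightarrow> nat \<Rightarrow> ('a::field vec \<Rightarrow> 'a vec \<Rightarrow> 'a) \<Rightarrow> bool" where
  "hermitian_form q n H \<longleftrightarrow>
    (\<forall>x\<in>carrier_vec n. \<forall>y\<in>carrier_vec n. \<forall>z\<in>carrier_vec n. H x (y + z) = H x y + H x z) \<and>
    (\<forall>x\<in>carrier_vec n. \<forall>y\<in>carrier_vec n. \<forall>c. H x (c \<cdot>\<^sub>v y) = c * H x y) \<and>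
    (\<forall>x\<in>carrier_vec n. \<forall>y\<in>carrier_vec n. H y x = H x y ^ q)"

definition isotropic :: "nat \<Rightarrow> ('a::field vec \<Rightarrow> 'a vec \<Rightarrow> 'a) \<Rightarrow> 'a vec set" where
  "isotropic n H = {x \<in> carrier_vec n. H x x = 0}"

definition radical :: "nat \<Rightarrow> ('a::field vec \<Rightarrow> 'a vec \<Rightarrow> 'a) \<Rightarrow> 'a vec set" where
  "radical n H = {x \<in> carrier_vec n. \<forall>y\<in>carrier_vec n. H y x = 0}"

text \<open>For hermitian \<open>H\<close> and \<open>H v v \<noteq> 0\<close> this is
  \<open>H\<close> composed in both arguments with the projection along \<open>v\<close> onto the
  orthogonal complement of \<open>v\<close>. It stays a form on the whole space, so the induction
  never changes the dimension.\<close>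

definition split_off :: "'a::field vec \<Rightarrow> ('a vec \<Rightarrow> 'a vec \<Rightarrow> 'a) \<Rightarrow> 'a vec \<Rightarrow> 'a vec \<Rightarrow> 'a" where
  "split_off v H x y = H x y - H x v * H v y / H v v"

context quadratic_extension
begin

context
  fixes n :: nat and H :: "'a vec \<Rightarrow> 'a vec \<Rightarrow> 'a"
  assumes herm: "hermitian_form q n H"
begin

lemma form_add_right:
  "x \<in> carrier_vec n \<Longrightarrow> y \<in> carrier_vec n \<Longrightarrow> z \<in> carrier_vec n \<Longrightarrow> H x (y + z) = H x y + H x z"
  and form_smult_right:
  "x \<in> carrier_vec n \<Longrightarrow> y \<in> carrier_vec n \<Longrightarrow> H x (c \<cdot>\<^sub>v y) = c * H x y"
  using herm unfolding hermitian_form_def by blast+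

lemma form_conj:
  assumes "x \<in> carrier_vec n" "y \<in> carrier_vec n"
  shows "H x y ^ q = H y x"
proof -
  have "H y x = H x y ^ q"
    using herm assms unfolding hermitian_form_def by blast
  then show ?thesis
    by (rule sym)
qed

lemma form_add_left:
  assumes "x \<in> carrier_vec n" "y \<in> carrier_vec n" "z \<in> carrier_vec n"
  shows "H (y + z) x = H y x + H z x"
  using form_conj[of x "y + z"] form_add_right[of x y z] assms by (simp add: conj_add form_conj)

lemma form_smult_left:
  assumes "x \<in> carrier_vec n" "y \<in> carrier_vec n"
  shows "H (c \<cdot>\<^sub>v y) x = c ^ q * H y x"
  using form_conj[of x "c \<cdot>\<^sub>v y"] form_smult_right[of x y c] assms
  by (simp add: power_mult_distrib form_conj)

lemmas form_simps = form_add_right form_smult_right form_add_left form_smult_left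

text \<open>By polarization, a form that vanishes on the diagonal has \<open>c * H x y + (c * H x y)\<^sup>q = 0\<close>
  for all \<open>c\<close>, which contradicts the nontriviality of the trace.\<close>
lemma ex_anisotropic:
  assumes "x \<in> carrier_vec n" "y \<in> carrier_vec n" "H x y \<noteq> 0"
  shows "\<exists>v\<in>carrier_vec n. H v v \<noteq> 0"
proof (rule ccontr)
  assume "\<not> ?thesis"
  then have diag: "H v v = 0" if "v \<in> carrier_vec n" for v
    using that by blast
  obtain c :: 'a where c: "c ^ q + c \<noteq> 0"
    using trace_nontrivial by blast
  define d where "d = c / H x y"
  have "H (x + d \<cdot>\<^sub>v y) (x + d \<cdot>\<^sub>v y) = d * H x y + d ^ q * H y x"
    using assms diag[of x] diag[of y] by (simp add: form_simps)
  also have "\<dots> = c + c ^ q"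
    using assms form_conj[of x y] by (auto simp: d_def power_divide)
  finally show False
    using c diag[of "x + d \<cdot>\<^sub>v y"] assms by (simp add: add.commute)
qed

section \<open>Splitting off one anisotropic vector\<close>

context
  fixes v :: "'a vec"
  assumes v: "v \<in> carrier_vec n" and aniso: "H v v \<noteq> 0"
begin

lemma minus_smult_add_cancel: "x \<in> carrier_vec n \<Longrightarrow> x - c \<cdot>\<^sub>v v + c \<cdot>\<^sub>v v = x"
  using v by (intro eq_vecI) auto

lemma split_off_conj:
  assumes "x \<in> carrier_vec n" "y \<in> carrier_vec n"
  shows "split_off v H x y ^ q = split_off v H y x"
proof -
  have "split_off v H x y ^ q = H x y ^ q - H x v ^ q * H v y ^ q / H v v ^ q"
    by (simp only: split_off_def conj_diff power_mult_distrib power_divide)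
  also have "\<dots> = split_off v H y x"
    using assms v by (simp only: form_conj split_off_def mult.commute)
  finally show ?thesis .
qed

lemma hermitian_form_split_off: "hermitian_form q n (split_off v H)"
  unfolding hermitian_form_def
proof (intro conjI ballI allI)
  fix x y z :: "'a vec"
  assume xyz: "x \<in> carrier_vec n" "y \<in> carrier_vec n" "z \<in> carrier_vec n"
  then show "split_off v H x (y + z) = split_off v H x y + split_off v H x z"
    using v by (simp add: split_off_def form_simps distrib_left add_divide_distrib)
next
  fix x y :: "'a vec" and c
  assume xy: "x \<in> carrier_vec n" "y \<in> carrier_vec n"
  then show "split_off v H x (c \<cdot>\<^sub>v y) = c * split_off v H x y"
    using v by (simp add: split_off_def form_simps right_diff_distrib mult.left_commute)
  show "split_off v H y x = split_off v H x y ^ q"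
    using split_off_conj[OF xy] by (rule sym)
qed

text \<open>The new radical is the direct sum of the old one and the line of \<open>v\<close>: the
  coefficient along \<open>v\<close> is \<open>H v z / H v v\<close>, and removing that component
  from \<open>z\<close> leaves a vector in the radical of \<open>H\<close>.\<close>

lemma bij_betw_radical_split_off:
  "bij_betw (\<lambda>(x, c). x + c \<cdot>\<^sub>v v) (radical n H \<times> UNIV) (radical n (split_off v H))"
proof (rule bij_betw_byWitness[where f' = "\<lambda>z. (z - (H v z / H v v) \<cdot>\<^sub>v v, H v z / H v v)"])
  have shift: "H y (z - c \<cdot>\<^sub>v v) = H y z - c * H y v"
    if "y \<in> carrier_vec n" "z \<in> carrier_vec n" for y z c
    using form_add_right[of y "z - c \<cdot>\<^sub>v v" "c \<cdot>\<^sub>v v"] that v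
    by (simp add: form_simps minus_smult_add_cancel)
  show "\<forall>a\<in>radical n H \<times> UNIV.
      (\<lambda>z. (z - (H v z / H v v) \<cdot>\<^sub>v v, H v z / H v v)) ((\<lambda>(x, c). x + c \<cdot>\<^sub>v v) a) = a"
    using v aniso by (auto simp: radical_def form_simps)
  show "\<forall>z\<in>radical n (split_off v H).
      (\<lambda>(x, c). x + c \<cdot>\<^sub>v v) (z - (H v z / H v v) \<cdot>\<^sub>v v, H v z / H v v) = z"
    using v by (auto simp: radical_def)
  show "(\<lambda>(x, c). x + c \<cdot>\<^sub>v v) ` (radical n H \<times> UNIV) \<subseteq> radical n (split_off v H)"
    using v aniso by (auto simp: radical_def split_off_def form_simps)
  show "(\<lambda>z. (z - (H v z / H v v) \<cdot>\<^sub>v v, H v z / H v v)) ` radical n (split_off v H)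
      \<subseteq> radical n H \<times> UNIV"
  proof clarsimp
    fix z
    assume "z \<in> radical n (split_off v H)"
    then have z: "z \<in> carrier_vec n"
      and "\<And>y. y \<in> carrier_vec n \<Longrightarrow> H y z - H y v * H v z / H v v = 0"
      by (simp_all add: radical_def split_off_def)
    then have "H y (z - (H v z / H v v) \<cdot>\<^sub>v v) = 0" if "y \<in> carrier_vec n" for y
      using that by (simp only: shift) (metis mult.commute times_divide_eq_right)
    then show "z - (H v z / H v v) \<cdot>\<^sub>v v \<in> radical n H"
      using z v by (simp add: radical_def)
  qed
qed

lemma card_radical_split_off: "card (radical n (split_off v H)) = q ^ 2 * card (radical n H)"
  using bij_betw_same_card[OF bij_betw_radical_split_off]
  by (simp add: card_cartesian_product card_field mult.commute)

text \<open>Completing the square: \<open>H v x + c * H v v\<close> is the pairing of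
  \<open>v\<close> with \<open>x + c \<cdot>\<^sub>v v\<close>, and \<open>split_off\<close> does
  not see the shift along \<open>v\<close>.\<close>

lemma form_on_line:
  assumes x: "x \<in> carrier_vec n"
  shows "H (x + c \<cdot>\<^sub>v v) (x + c \<cdot>\<^sub>v v) = split_off v H x x + (H v x + c * H v v) ^ (q + 1) / H v v"
proof -
  have "H v x ^ q = H x v" "H v v ^ q = H v v"
    using form_conj v x by auto
  then have "(H v x + c * H v v) ^ (q + 1) = (H v x + c * H v v) * (H x v + c ^ q * H v v)"
    by (simp add: conj_add power_mult_distrib)
  also have "\<dots> = H v x * H x v + H v v * (c * H x v + c ^ q * (H v x + c * H v v))"
    by (simp add: algebra_simps)
  finally have "(H v x + c * H v v) ^ (q + 1) / H v v
      = H x v * H v x / H v v + (c * H x v + c ^ q * (H v x + c * H v v))"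
    using aniso by (simp only: add_divide_distrib) (simp add: mult.commute)
  then show ?thesis
    using v x by (simp add: split_off_def form_simps distrib_left)
qed

text \<open>By \<open>form_on_line\<close>, isotropy says that an affine bijection of
  \<open>c\<close> takes its values in one norm fibre, that of \<open>t\<close>. The fibre over zero
  is a single point, the one over a nonzero conjugation-fixed element has \<open>q + 1\<close>
  points.\<close>

lemma card_isotropic_on_line:
  assumes x: "x \<in> carrier_vec n"
  shows "card {c. x + c \<cdot>\<^sub>v v \<in> isotropic n H} = (if x \<in> isotropic n (split_off v H) then 1 else q + 1)"
proof -
  define t where "t = - (split_off v H x x * H v v)"
  have "split_off v H x x ^ q = split_off v H x x"
    using split_off_conj[OF x x] .
  then have "t ^ q = t"
    using form_conj[OF v v] by (simp add: t_def conj_minus power_mult_distrib)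
  have iso_iff: "x + c \<cdot>\<^sub>v v \<in> isotropic n H \<longleftrightarrow> (H v x + c * H v v) ^ (q + 1) = t" for c
  proof -
    have "x + c \<cdot>\<^sub>v v \<in> isotropic n H
        \<longleftrightarrow> split_off v H x x + (H v x + c * H v v) ^ (q + 1) / H v v = 0"
      using x v by (simp add: isotropic_def form_on_line del: power_add power_Suc)
    also have "\<dots> \<longleftrightarrow> (H v x + c * H v v) ^ (q + 1) / H v v = - split_off v H x x"
      by (metis add_eq_0_iff)
    also have "\<dots> \<longleftrightarrow> (H v x + c * H v v) ^ (q + 1) = t"
      using aniso by (simp only: divide_eq_eq t_def) simp
    finally show ?thesis .
  qed
  have "bij_betw (\<lambda>c. H v x + c * H v v) {c. x + c \<cdot>\<^sub>v v \<in> isotropic n H} {s. s ^ (q + 1) = t}"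
    unfolding iso_iff
    by (rule bij_betw_byWitness[where f' = "\<lambda>s. (s - H v x) / H v v"])
      (use aniso in \<open>auto simp del: power_add power_Suc\<close>)
  then have eq: "card {c. x + c \<cdot>\<^sub>v v \<in> isotropic n H} = card {s. s ^ (q + 1) = t}"
    by (rule bij_betw_same_card)
  show ?thesis
  proof (cases "t = 0")
    case True
    then have "{s. s ^ (q + 1) = t} = {0}" "x \<in> isotropic n (split_off v H)"
      using aniso x by (auto simp: t_def isotropic_def)
    then show ?thesis
      by (simp add: eq)
  next
    case False
    then have "x \<notin> isotropic n (split_off v H)"
      by (auto simp: t_def isotropic_def)
    then show ?thesis
      using card_norm_fibre[OF \<open>t ^ q = t\<close> False] eq by simp
  qed
qed

text \<open>Double count of the pairs \<open>(x, c)\<close> with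
  \<open>x + c \<cdot>\<^sub>v v\<close> isotropic: for fixed \<open>c\<close> translation is a
  bijection, for fixed \<open>x\<close> the count on the line applies.\<close>

lemma card_isotropic_split_off:
  "q ^ 2 * card (isotropic n H) + q * card (isotropic n (split_off v H)) = (q + 1) * (q ^ 2) ^ n"
proof -
  let ?V = "carrier_vec n :: 'a vec set" and ?I = "isotropic n (split_off v H)"
  have fin: "finite ?V"
    by (rule finite_carrier_vec)
  have sub: "?I \<subseteq> ?V"
    by (auto simp: isotropic_def)
  have translate: "card {x \<in> ?V. x + c \<cdot>\<^sub>v v \<in> isotropic n H} = card (isotropic n H)" for c
  proof -
    have "bij_betw (\<lambda>x. x + c \<cdot>\<^sub>v v) {x \<in> ?V. x + c \<cdot>\<^sub>v v \<in> isotropic n H} (isotropic n H)"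
      by (rule bij_betw_byWitness[where f' = "\<lambda>x. x - c \<cdot>\<^sub>v v"])
        (use v in \<open>auto simp: isotropic_def minus_smult_add_cancel\<close>)
    then show ?thesis
      by (rule bij_betw_same_card)
  qed
  have "q ^ 2 * card (isotropic n H)
      = (\<Sum>c\<in>(UNIV :: 'a set). card {x \<in> ?V. x + c \<cdot>\<^sub>v v \<in> isotropic n H})"
    by (simp add: translate card_field)
  also have "\<dots> = (\<Sum>x\<in>?V. card {c. x + c \<cdot>\<^sub>v v \<in> isotropic n H})"
    using sum.swap_restrict[of UNIV ?V "\<lambda>_ _. 1 :: nat" "\<lambda>c x. x + c \<cdot>\<^sub>v v \<in> isotropic n H"] fin
    by simp
  also have "\<dots> = (\<Sum>x\<in>?V. if x \<in> ?I then 1 else q + 1)"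
    by (rule sum.cong) (auto simp: card_isotropic_on_line)
  also have "\<dots> = (\<Sum>x\<in>?I. 1) + (\<Sum>x\<in>?V - ?I. q + 1)"
    using fin sub by (subst sum.subset_diff[OF sub fin]) (simp add: add.commute)
  also have "\<dots> = card ?I + (q + 1) * (card ?V - card ?I)"
    using fin sub by (simp add: card_Diff_subset finite_subset)
  finally have "q ^ 2 * card (isotropic n H) = card ?I + (q + 1) * (card ?V - card ?I)" .
  \<comment> \<open>Ensures that the subtraction of naturals above is not truncated.\<close>
  moreover have "card ?I \<le> card ?V"
    using fin sub by (rule card_mono)
  moreover have "card ?V = (q ^ 2) ^ n"
    by (simp add: card_carrier_vec card_field)
  ultimately show ?thesis
    by (auto simp: algebra_simps le_iff_add)
qed

end

end

text \<open>Here \<open>k\<close> is the number of vectors split off until the form vanishes, that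
  is, the codimension of the radical. The induction measure is the number of vectors outside the
  radical.\<close>

lemma card_isotropic_aux:
  fixes H :: "'a vec \<Rightarrow> 'a vec \<Rightarrow> 'a"
  assumes "hermitian_form q n H"
  shows "\<exists>k. card (radical n H) * (q ^ 2) ^ k = (q ^ 2) ^ n \<and>
    int (q * card (isotropic n H)) = (q ^ 2) ^ n + (- 1) ^ k * (int q - 1) * (card (radical n H) * q ^ k)"
  using assms
proof (induction "(q ^ 2) ^ n - card (radical n H)" arbitrary: H rule: less_induct)
  case less
  let ?V = "carrier_vec n :: 'a vec set"
  have fin: "finite ?V"
    by (rule finite_carrier_vec)
  have cV: "card ?V = (q ^ 2) ^ n"
    by (simp add: card_carrier_vec card_field)
  show ?case
  proof (cases "\<exists>x\<in>?V. \<exists>y\<in>?V. H x y \<noteq> 0")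
    case False
    then have "radical n H = ?V" "isotropic n H = ?V"
      by (auto simp: radical_def isotropic_def)
    then show ?thesis
      by (intro exI[of _ 0]) (simp add: cV algebra_simps)
  next
    case True
    then obtain v where v: "v \<in> ?V" "H v v \<noteq> 0"
      using ex_anisotropic[OF less.prems] by blast
    let ?H' = "split_off v H"
    note radical' = card_radical_split_off[OF less.prems v]
    \<comment> \<open>Makes the radical nonempty, so that the factor \<open>q ^ 2\<close> strictly
      enlarges it and the measure drops.\<close>
    have "H y (0\<^sub>v n) = 0" if "y \<in> ?V" for y
    proof -
      have "H y (0\<^sub>v n) = H y (0\<^sub>v n) + H y (0\<^sub>v n)"
        using form_add_right[OF less.prems that zero_carrier_vec zero_carrier_vec]
        by (simp only: right_zero_vec[OF zero_carrier_vec])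
      then show ?thesis
        by (metis add_cancel_right_right)
    qed
    then have "0\<^sub>v n \<in> radical n H"
      by (simp add: radical_def)
    moreover have "finite (radical n H)"
      by (rule finite_subset[OF _ fin]) (auto simp: radical_def)
    ultimately have "card (radical n H) > 0"
      by (auto simp: card_gt_0_iff)
    then have "card (radical n H) < card (radical n ?H')"
      using one_less_power[OF q_gt_1, of 2] by (simp add: radical')
    moreover have "card (radical n ?H') \<le> (q ^ 2) ^ n"
      unfolding cV[symmetric] by (rule card_mono[OF fin]) (auto simp: radical_def)
    ultimately obtain k where k: "card (radical n ?H') * (q ^ 2) ^ k = (q ^ 2) ^ n"
      and iso': "int (q * card (isotropic n ?H'))
        = (q ^ 2) ^ n + (- 1) ^ k * (int q - 1) * (card (radical n ?H') * q ^ k)"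
      using less.hyps[OF _ hermitian_form_split_off[OF less.prems v]] by (meson diff_less_mono2 less_le_trans)
    have "int (q ^ 2 * card (isotropic n H)) + int (q * card (isotropic n ?H')) = (int q + 1) * (q ^ 2) ^ n"
      using card_isotropic_split_off[OF less.prems v] by (metis of_nat_1 of_nat_add of_nat_mult)
    \<comment> \<open>Subtracting the count for \<open>?H'\<close> flips the sign. Of the factor
      \<open>q ^ 2\<close> gained by its radical, one \<open>q\<close> is pulled out and the other
      turns \<open>q ^ k\<close> into \<open>q ^ Suc k\<close>.\<close>
    then have "int q * int (q * card (isotropic n H))
        = int q * ((q ^ 2) ^ n + (- 1) ^ Suc k * (int q - 1) * (card (radical n H) * q ^ Suc k))"
      unfolding iso' radical' by (simp add: algebra_simps power2_eq_square)
    then have "int (q * card (isotropic n H))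
        = (q ^ 2) ^ n + (- 1) ^ Suc k * (int q - 1) * (card (radical n H) * q ^ Suc k)"
      using q_gt_1 by (subst (asm) mult_left_cancel) auto
    moreover have "card (radical n H) * (q ^ 2) ^ Suc k = (q ^ 2) ^ n"
      using k unfolding radical' by (simp add: algebra_simps)
    ultimately show ?thesis
      by blast
  qed
qed

text \<open>The size of the radical determines \<open>k\<close>, because powers of
  \<open>q ^ 2\<close> are injective in the exponent.\<close>

lemma card_isotropic:
  fixes H :: "'a vec \<Rightarrow> 'a vec \<Rightarrow> 'a"
  assumes "hermitian_form q n H" and radical: "card (radical n H) * (q ^ 2) ^ k = (q ^ 2) ^ n"
  shows "int (q * card (isotropic n H))
    = (q ^ 2) ^ n + (- 1) ^ k * (int q - 1) * (card (radical n H) * q ^ k)"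
proof -
  obtain j where j: "card (radical n H) * (q ^ 2) ^ j = (q ^ 2) ^ n"
    and iso: "int (q * card (isotropic n H))
      = (q ^ 2) ^ n + (- 1) ^ j * (int q - 1) * (card (radical n H) * q ^ j)"
    using card_isotropic_aux[OF assms(1)] by blast
  have "card (radical n H) \<noteq> 0"
    using j q_gt_1 by (metis mult_is_0 not_one_less_zero power_not_zero)
  then have "(q ^ 2) ^ j = (q ^ 2) ^ k"
    using j radical by (metis mult_left_cancel)
  then have "j = k"
    using q_gt_1 by (simp add: power_inject_exp flip: power_mult)
  then show ?thesis
    using iso by simp
qed

end

section \<open>Counting agreements of hermitian matrices\<close>

text \<open>The sesquilinear form \<open>x^* A y\<close>, with the conjugation on
  \<open>x\<close>.\<close>

definition mat_form :: "nat \<Rightarrow> nat \<Rightarrow> 'a::field mat \<Rightarrow> 'a vec \<Rightarrow> 'a vec \<Rightarrow> 'a" where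
  "mat_form q n A x y = (\<Sum>i<n. \<Sum>j<n. (x $ i) ^ q * A $$ (i, j) * y $ j)"

lemma mat_form_diff:
  assumes "A \<in> carrier_mat n n" "B \<in> carrier_mat n n"
  shows "mat_form q n (A - B) x y = mat_form q n A x y - mat_form q n B x y"
  using assms by (simp add: mat_form_def sum_subtractf algebra_simps)

lemma mat_form_eq_sum_mult_vec:
  assumes "A \<in> carrier_mat n n" "y \<in> carrier_vec n"
  shows "mat_form q n A x y = (\<Sum>i<n. (x $ i) ^ q * (A *\<^sub>v y) $ i)"
  using assms
  by (simp add: mat_form_def scalar_prod_def sum_distrib_left mult.assoc lessThan_atLeast0)

section \<open>The form of a hermitian matrix, its radical and its isotropic vectors\<close>

context quadratic_extension
begin

lemma hermitian_form_mat_form: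
  assumes A: "A \<in> hermitian_mats q n"
  shows "hermitian_form q n (mat_form q n (A :: 'a mat))"
  unfolding hermitian_form_def
proof (intro conjI ballI allI)
  fix x y z :: "'a vec"
  assume xyz: "x \<in> carrier_vec n" "y \<in> carrier_vec n" "z \<in> carrier_vec n"
  then show "mat_form q n A x (y + z) = mat_form q n A x y + mat_form q n A x z"
    by (simp add: mat_form_def distrib_left sum.distrib)
next
  fix x y :: "'a vec" and c
  assume xy: "x \<in> carrier_vec n" "y \<in> carrier_vec n"
  then show "mat_form q n A x (c \<cdot>\<^sub>v y) = c * mat_form q n A x y"
    by (simp add: mat_form_def sum_distrib_left mult_ac)
  have entry: "(A $$ (i, j)) ^ q = A $$ (j, i)" if "i < n" "j < n" for i j
  proof -
    have "dim_row A = n" "dim_col A = n" "transpose_mat (conj_mat q A) = A"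
      using A by (auto simp: hermitian_mats_def)
    then have "A $$ (j, i) = transpose_mat (conj_mat q A) $$ (j, i)"
      by simp
    also have "\<dots> = (A $$ (i, j)) ^ q"
      using that \<open>dim_row A = n\<close> \<open>dim_col A = n\<close> by (simp add: conj_mat_def)
    finally show ?thesis
      by (rule sym)
  qed
  have "mat_form q n A x y ^ q = (\<Sum>i<n. \<Sum>j<n. x $ i * (A $$ (i, j)) ^ q * (y $ j) ^ q)"
    by (simp add: mat_form_def conj_sum power_mult_distrib conj_conj)
  also have "\<dots> = (\<Sum>i<n. \<Sum>j<n. (y $ j) ^ q * A $$ (j, i) * x $ i)"
    by (intro sum.cong refl) (simp add: entry mult_ac)
  also have "\<dots> = mat_form q n A y x"
    unfolding mat_form_def by (rule sum.swap)
  finally show "mat_form q n A y x = mat_form q n A x y ^ q"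
    by (rule sym)
qed

text \<open>Pairing with the unit vectors reads off the coordinates of \<open>A *\<^sub>v x\<close>.
  This links the radical to the rank of the matrix.\<close>

lemma radical_mat_form:
  fixes A :: "'a mat"
  assumes A: "A \<in> carrier_mat n n"
  shows "radical n (mat_form q n A) = {x \<in> carrier_vec n. A *\<^sub>v x = 0\<^sub>v n}"
proof (intro equalityI subsetI)
  fix x
  assume x: "x \<in> radical n (mat_form q n A)"
  then have xV: "x \<in> carrier_vec n"
    by (simp add: radical_def)
  have "A *\<^sub>v x = 0\<^sub>v n"
  proof (rule eq_vecI)
    fix i
    assume "i < dim_vec (0\<^sub>v n :: 'a vec)"
    then have i: "i < n"
      by simp
    have "0 = mat_form q n A (unit_vec n i) x"
      using x by (simp add: radical_def)
    also have "\<dots> = (\<Sum>k<n. if k = i then (A *\<^sub>v x) $ k else 0)"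
      unfolding mat_form_eq_sum_mult_vec[OF A xV]
      using i q_gt_1 by (intro sum.cong) (auto simp: power_0_left)
    also have "\<dots> = (A *\<^sub>v x) $ i"
      using i by simp
    finally show "(A *\<^sub>v x) $ i = 0\<^sub>v n $ i"
      using i by simp
  qed (use A in auto)
  then show "x \<in> {x \<in> carrier_vec n. A *\<^sub>v x = 0\<^sub>v n}"
    using xV by simp
next
  fix x
  assume "x \<in> {x \<in> carrier_vec n. A *\<^sub>v x = 0\<^sub>v n}"
  then show "x \<in> radical n (mat_form q n A)"
    using mat_form_eq_sum_mult_vec[OF A] by (simp add: radical_def)
qed

text \<open>Rank-nullity turns \<open>R * q ^ k\<close> into \<open>q ^ (2 * n - k)\<close>, and odd
  \<open>k\<close> makes the correction term negative.\<close>

lemma card_isotropic_mat_form: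
  fixes A :: "'a mat"
  assumes A: "A \<in> hermitian_mats q n" and rank: "vec_space.rank n A = k" and "odd k" "k \<le> n"
  shows "int (q * card (isotropic n (mat_form q n A)))
    = int q ^ (2 * n) - (int q - 1) * int q ^ (2 * n - k)"
proof -
  have A': "A \<in> carrier_mat n n"
    using A by (simp add: hermitian_mats_def)
  define R where "R = card (radical n (mat_form q n A))"
  have R: "R * (q ^ 2) ^ k = (q ^ 2) ^ n"
    using card_mat_kernel_times_rank[OF A'] by (simp add: R_def radical_mat_form[OF A'] rank card_field)
  then have "R * q ^ k * q ^ k = q ^ (2 * n - k) * q ^ k"
    using \<open>k \<le> n\<close> by (simp add: mult_2 mult.assoc flip: power_mult power_add)
  then have "R * q ^ k = q ^ (2 * n - k)"
    using q_gt_1 by simp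
  then have "int (R * q ^ k) = int q ^ (2 * n - k)"
    by simp
  then show ?thesis
    using card_isotropic[OF hermitian_form_mat_form[OF A] R[unfolded R_def]] \<open>odd k\<close>
    by (simp add: R_def power_mult left_diff_distrib)
qed

lemma hermitian_mats_diff:
  assumes A: "A \<in> hermitian_mats q n" and B: "(B :: 'a mat) \<in> hermitian_mats q n"
  shows "A - B \<in> hermitian_mats q n"
proof -
  have dim: "A \<in> carrier_mat n n" "B \<in> carrier_mat n n"
    using A B by (simp_all add: hermitian_mats_def)
  then have "conj_mat q (A - B) = conj_mat q A - conj_mat q B"
    by (intro eq_matI) (auto simp: conj_mat_def conj_diff)
  then have "transpose_mat (conj_mat q (A - B)) = transpose_mat (conj_mat q A) - transpose_mat (conj_mat q B)"
    using dim by (intro eq_matI) (auto simp: conj_mat_def)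
  then show ?thesis
    using A B dim minus_carrier_mat[OF dim(2)] by (simp add: hermitian_mats_def)
qed

end

text \<open>Cauchy-Schwarz for the fibre sizes \<open>m t\<close>: they add up to
  \<open>card U\<close>, and their squares add up to the number of ordered pairs with equal values,
  diagonal included.\<close>

lemma card_power2_le_card_collisions:
  assumes "finite U" "finite T" "f ` U \<subseteq> T"
  shows "(card U)\<^sup>2 \<le> card T * card {(a, b) \<in> U \<times> U. f a = f b}"
proof -
  define m where "m t = card {a \<in> U. f a = t}" for t
  have "card U = (\<Sum>t\<in>T. m t)"
    using sum_fun_comp[of U T f "\<lambda>_. 1 :: nat"] assms by (simp add: m_def)
  then have "(real (card U))\<^sup>2 = (\<Sum>t\<in>T. real (m t))\<^sup>2"
    by simp
  also have "\<dots> \<le> (\<Sum>t\<in>T. (real (m t))\<^sup>2) * card T"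
    by (rule sum_squared_le_sum_of_squares)
  finally have "real ((card U)\<^sup>2) \<le> real (card T * (\<Sum>t\<in>T. (m t)\<^sup>2))"
    by (simp add: mult.commute)
  then have "(card U)\<^sup>2 \<le> card T * (\<Sum>t\<in>T. (m t)\<^sup>2)"
    by (simp only: of_nat_le_iff)
  also have "(\<Sum>t\<in>T. (m t)\<^sup>2) = (\<Sum>t\<in>T. card ({a \<in> U. f a = t} \<times> {a \<in> U. f a = t}))"
    by (simp add: m_def card_cartesian_product power2_eq_square)
  also have "\<dots> = card (\<Union>t\<in>T. {a \<in> U. f a = t} \<times> {a \<in> U. f a = t})"
    using assms by (intro card_UN_disjoint[symmetric]) auto
  also have "(\<Union>t\<in>T. {a \<in> U. f a = t} \<times> {a \<in> U. f a = t}) = {(a, b) \<in> U \<times> U. f a = f b}"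
    using assms(3) by auto
  finally show ?thesis .
qed

section \<open>Double count of vectors against agreeing pairs of matrices\<close>

theorem theorem4p3:
  fixes q n k :: nat
    and U :: "'a::{field,finite} mat set"
  assumes "primepow q"
    and "CARD('a) = q ^ 2"
    and "n \<ge> 1"
    and "odd k"
    and "1 \<le> k"
    and "k \<le> n"
    and "U \<subseteq> hermitian_mats q n"
    and "constant_rank_distance_set n k U"
  shows "card U \<le> q ^ k"
proof (rule ccontr)
  interpret quadratic_extension q "TYPE('a)"
    using assms(1,2) by unfold_locales
  let ?V = "carrier_vec n :: 'a vec set"
  let ?Q = "\<lambda>A x. mat_form q n A x x"
  define m where "m = card U"
  \<comment> \<open>\<open>X\<close> is the number of vectors; \<open>(q - 1) * W\<close> is the
    amount by which \<open>q\<close> times the agreement count of two distinct matrices falls short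
    of \<open>X\<close>.\<close>
  define X where "X = int q ^ (2 * n)"
  define W where "W = int q ^ (2 * n - k)"
  define C where "C x = card {(A, B) \<in> U \<times> U. ?Q A x = ?Q B x}" for x
  assume "\<not> card U \<le> q ^ k"
  then have m: "m \<ge> q ^ k + 1"
    by (simp add: m_def)
  have finU: "finite U"
    using assms(7) finite_hermitian_mats by (rule finite_subset)
  have finV: "finite ?V"
    by (rule finite_carrier_vec)
  have cV: "int (card ?V) = X"
    by (simp add: card_carrier_vec assms(2) X_def power_mult)
  have carrier: "A \<in> carrier_mat n n" if "A \<in> U" for A
    using that assms(7) by (auto simp: hermitian_mats_def)
  have C_ge: "m\<^sup>2 \<le> q * C x" if x: "x \<in> ?V" for x
  proof -
    \<comment> \<open>Conjugate symmetry with both arguments equal to \<open>x\<close> fixes the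
      value under conjugation.\<close>
    have "(\<lambda>A. ?Q A x) ` U \<subseteq> {t. t ^ q = t}"
      using form_conj[OF hermitian_form_mat_form x x] assms(7) by blast
    then have "m\<^sup>2 \<le> card {t :: 'a. t ^ q = t} * C x"
      unfolding m_def C_def by (intro card_power2_le_card_collisions finU) auto
    also have "\<dots> \<le> q * C x"
      by (rule mult_le_mono1[OF card_conj_fixed_le])
    finally show ?thesis .
  qed
  have "?Q A (0\<^sub>v n) = 0" for A :: "'a mat"
    by (simp add: mat_form_def)
  \<comment> \<open>At zero all pairs agree, which beats \<open>C_ge\<close> by the factor
    \<open>q\<close>; this gain removes the final off-by-one.\<close>
  then have C_0: "C (0\<^sub>v n) = m\<^sup>2"
    by (simp add: C_def m_def card_cartesian_product power2_eq_square)
  have pair: "card {x \<in> ?V. ?Q A x = ?Q B x} = card (isotropic n (mat_form q n (A - B)))"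
    if "A \<in> U" "B \<in> U" for A B
    using mat_form_diff[OF carrier carrier, OF that] by (simp add: isotropic_def)
  have pair_eq: "int (q * card {x \<in> ?V. ?Q A x = ?Q A x}) = q * X" for A
    by (simp add: cV)
  have pair_neq: "int (q * card {x \<in> ?V. ?Q A x = ?Q B x}) = X - (int q - 1) * W"
    if "A \<in> U" "B \<in> U" "A \<noteq> B" for A B
  proof -
    have "A - B \<in> hermitian_mats q n"
      using that assms(7) by (intro hermitian_mats_diff) auto
    moreover have "vec_space.rank n (A - B) = k"
      using that assms(8) by (simp add: constant_rank_distance_set_def)
    ultimately show ?thesis
      using card_isotropic_mat_form assms(4,6) pair[OF that(1,2)] by (simp add: X_def W_def)
  qed
  have "(X - 1) * (int m)\<^sup>2 + q * (int m)\<^sup>2 \<le> (\<Sum>x\<in>?V. int (q * C x))"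
  proof -
    have "(\<Sum>x\<in>?V - {0\<^sub>v n}. (int m)\<^sup>2) \<le> (\<Sum>x\<in>?V - {0\<^sub>v n}. int (q * C x))"
      using C_ge by (intro sum_mono) (simp flip: of_nat_power of_nat_mult)
    moreover have "int (card (?V - {0\<^sub>v n})) = X - 1"
    proof -
      have "card ?V = Suc (card (?V - {0\<^sub>v n}))"
        using finV by (intro card.remove) auto
      then show ?thesis
        using cV by simp
    qed
    ultimately show ?thesis
      using finV by (subst sum.remove[of ?V "0\<^sub>v n"]) (simp_all add: C_0)
  qed
  \<comment> \<open>Both sides are \<open>q\<close> times the number of triples
    \<open>(x, A, B)\<close> with agreement at \<open>x\<close>.\<close>
  also have "(\<Sum>x\<in>?V. int (q * C x)) = (\<Sum>(A, B)\<in>U \<times> U. int (q * card {x \<in> ?V. ?Q A x = ?Q B x}))"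
  proof -
    have "(\<Sum>x\<in>?V. C x) = (\<Sum>(A, B)\<in>U \<times> U. card {x \<in> ?V. ?Q A x = ?Q B x})"
      using sum.swap_restrict[of ?V "U \<times> U" "\<lambda>_ _. 1 :: nat" "\<lambda>x (A, B). ?Q A x = ?Q B x"] finV finU
      by (simp add: C_def case_prod_unfold mem_Times_iff)
    then have "int (q * (\<Sum>x\<in>?V. C x)) = int (q * (\<Sum>(A, B)\<in>U \<times> U. card {x \<in> ?V. ?Q A x = ?Q B x}))"
      by simp
    then show ?thesis
      by (simp add: sum_distrib_left case_prod_unfold)
  qed
  also have "\<dots> = (\<Sum>A\<in>U. \<Sum>B\<in>U. int (q * card {x \<in> ?V. ?Q A x = ?Q B x}))"
    by (rule sum.cartesian_product[symmetric])
  \<comment> \<open>For fixed \<open>A\<close>, the term \<open>B = A\<close> agrees everywhere and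
    the other \<open>m - 1\<close> terms are given by \<open>pair_neq\<close>.\<close>
  also have "\<dots> = (\<Sum>A\<in>U. q * X + (int m - 1) * (X - (int q - 1) * W))"
  proof (rule sum.cong[OF refl])
    fix A
    assume A: "A \<in> U"
    have "(\<Sum>B\<in>U. int (q * card {x \<in> ?V. ?Q A x = ?Q B x}))
        = q * X + (\<Sum>B\<in>U - {A}. int (q * card {x \<in> ?V. ?Q A x = ?Q B x}))"
      using sum.remove[OF finU A, of "\<lambda>B. int (q * card {x \<in> ?V. ?Q A x = ?Q B x})"] pair_eq by simp
    also have "\<dots> = q * X + (\<Sum>B\<in>U - {A}. X - (int q - 1) * W)"
      using pair_neq[OF A] by (intro arg_cong2[where f = "(+)"] sum.cong) auto
    also have "int (card (U - {A})) = int m - 1"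
      using finU A m by (simp add: m_def of_nat_diff)
    then have "(\<Sum>B\<in>U - {A}. X - (int q - 1) * W) = (int m - 1) * (X - (int q - 1) * W)"
      by simp
    finally show "(\<Sum>B\<in>U. int (q * card {x \<in> ?V. ?Q A x = ?Q B x}))
        = q * X + (int m - 1) * (X - (int q - 1) * W)" .
  qed
  also have "\<dots> = int m * (q * X + (int m - 1) * (X - (int q - 1) * W))"
    by (simp add: m_def)
  finally have "int m * ((X - 1 + int q) * int m) \<le> int m * (q * X + (int m - 1) * (X - (int q - 1) * W))"
    by (simp add: algebra_simps power2_eq_square)
  then have "(X - 1 + int q) * int m \<le> q * X + (int m - 1) * (X - (int q - 1) * W)"
    using m by (subst (asm) mult_le_cancel_left_pos) auto
  \<comment> \<open>The products \<open>X * m\<close> cancel and all remaining terms share the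
    factor \<open>q - 1\<close>. The summand \<open>int m\<close> is the gain at the zero
    vector.\<close>
  then have "(int q - 1) * (int m + (int m - 1) * W) \<le> (int q - 1) * X"
    by (simp add: algebra_simps)
  then have "int m + (int m - 1) * W \<le> X"
    using q_gt_1 by (subst (asm) mult_le_cancel_left_pos) auto
  moreover have "int q ^ k * W = X"
    using assms(6) by (simp add: W_def X_def flip: power_add)
  \<comment> \<open>Hence \<open>(m - 1) * W\<close> alone reaches \<open>X\<close>, leaving
    \<open>m \<le> 0\<close>. Without the summand \<open>int m\<close> the case
    \<open>m = q ^ k + 1\<close> would survive.\<close>
  moreover have "int q ^ k * W \<le> (int m - 1) * W"
  proof (rule mult_right_mono)
    have "int (q ^ k + 1) \<le> int m"
      using m by (simp only: of_nat_le_iff)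
    then show "int q ^ k \<le> int m - 1"
      unfolding of_nat_add of_nat_power of_nat_1 by linarith
    show "0 \<le> W"
      by (simp add: W_def)
  qed
  ultimately show False
    using m by linarith
qed

end
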